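(* Consider an $L$-ball weighted least squares subdivision scheme with coefficients $\alpha^{k+1,\ell}_i$. Let $\boldsymbol\epsilon^0=(\epsilon^0_i)_{i=1}^{N^0}$ be noise consisting of independent and identically distributed real random variables with the distribution of a random variable $X$ with mean zero and finite variance $\mathbb V(X)$, and let $\boldsymbol\epsilon^{k+1}=S^k\boldsymbol\epsilon^k$ for $k\ge0$. Denote by $X^k_\ell$ the (distribution of the) random value $\epsilon^k_\ell$. If all the coefficients $\alpha^{k+1,\ell}_i$ are non-negative, then for every $k\ge1$ and every $\ell\in\{1,\dots,N^k\}$ $$\mathbb V(X^k_\ell)\le\theta\,\mathbb V(X),\qquad\text{where}\quad \theta=\max_{\ell\in\{1,\dots,N^1\}}\ \sum_{i\in\mathcal B^{1,\ell}}\left(\alpha^{1,\ell}_i\right)^2 .$$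
   Context: Triangulations. $T^0=(V^0,E^0)$ is a triangulation in the plane with vertices $V^0=\{\mathbf v^0_1,\dots,\mathbf v^0_{N^0}\}\subset\mathbb R^2$ and edges $E^0\subset\{1,\dots,N^0\}^2$ ($(i,j)\in E^0$ means that $\mathbf v^0_i,\mathbf v^0_j$ are connected by an edge); faces are non-degenerate triangles and every vertex and edge belongs to a face. $T^{k+1}=(V^{k+1},E^{k+1})$ is obtained from $T^k$ by adding the mid-point of every edge and splitting every face into four similar faces; thus each $\mathbf v^{k+1}_\ell\in V^{k+1}$, $\ell=1,\dots,N^{k+1}$, is either a vertex or an edge mid-point of $T^k$. Scheme. Fix $L>\sup\{\|\mathbf v^0_i-\mathbf v^0_j\|:(i,j)\in E^0\}$ (Euclidean norm) and a weight function $W:[0,1)\to(0,1]$. Let $\Pi_1$ be the space of bivariate polynomials of degree at most $1$. For $k\ge0$, $\ell=1,\dots,N^{k+1}$, put $$\mathcal B^{k+1,\ell}=\{j\in\{1,\dots,N^k\}:\|\mathbf v^k_j-\mathbf v^{k+1}_\ell\|<2^{-k}L\},\qquad w^{k+1,\ell}_i=W\!\left(\frac{\|\mathbf v^{k+1}_\ell-\mathbf v^k_i\|}{2^{-k}L}\right),\ i\in\mathcal B^{k+1,\ell}.$$ Given data $\mathbf z^k=(z^k_j)_{j=1}^{N^k}$ attached to $V^k$, the new datum $z^{k+1}_\ell$ is $\hat p(\mathbf v^{k+1}_\ell)$, where $\hat p\in\Pi_1$ minimizes $\sum_{i\in\mathcal B^{k+1,\ell}}w^{k+1,\ell}_i\,(p(\mathbf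 v^k_i)-z^k_i)^2$ over $p\in\Pi_1$. Explicitly, $$z^{k+1}_\ell=\sum_{i\in\mathcal B^{k+1,\ell}}\alpha^{k+1,\ell}_i z^k_i,\qquad \alpha^{k+1,\ell}_i=\frac{w^{k+1,\ell}_i\mu^{k+1,\ell}_i}{\sum_{j\in\mathcal B^{k+1,\ell}}w^{k+1,\ell}_j\mu^{k+1,\ell}_j},$$ $$\mu^{k+1,\ell}_i=\sum_{\substack{j_1,j_2\in\mathcal B^{k+1,\ell}\\ j_1<j_2}}w^{k+1,\ell}_{j_1}w^{k+1,\ell}_{j_2}\begin{vmatrix}1&1&1\\ \mathbf v^{k+1}_\ell&\mathbf v^k_{j_1}&\mathbf v^k_{j_2}\end{vmatrix}\begin{vmatrix}1&1&1\\ \mathbf v^k_i&\mathbf v^k_{j_1}&\mathbf v^k_{j_2}\end{vmatrix},$$ where points of $\mathbb R^2$ are written as columns. The linear map $\mathbf z^k\mapsto\mathbf z^{k+1}$, $\mathbb R^{N^k}\to\mathbb R^{N^{k+1}}$, is denoted $S^k$. $\mathbb V$ denotes variance. *)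

theory Defs
  imports "HOL-Analysis.Analysis" "HOL-Probability.Probability"
begin

text \<open>Vertices are indexed by \<open>{1..nvert T}\<close>. An edge is listed in both orientations. A face is
  given by the set of its three corners; the triangle itself is their convex hull.\<close>

record mesh =
  nvert :: nat
  vert :: "nat \<Rightarrow> real^2"
  edges :: "(nat \<times> nat) set"
  faces :: "(real^2) set set"

definition vertices :: "mesh \<Rightarrow> (real^2) set" where
  "vertices T = vert T ` {1..nvert T}"

definition face_edges :: "mesh \<Rightarrow> (nat \<times> nat) set" where
  "face_edges T = {(i, j). i \<in> {1..nvert T} \<and> j \<in> {1..nvert T} \<and> i \<noteq> j \<and>
     (\<exists>t\<in>faces T. vert T i \<in> t \<and> vert T j \<in> t)}"

text \<open>The library predicate \<^const>\<open>triangulation\<close> says that there are finitely many cells and that two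
  of them meet in a common (possibly empty) face of both.\<close>

definition is_triangulation :: "mesh \<Rightarrow> bool" where
  "is_triangulation T \<longleftrightarrow>
     inj_on (vert T) {1..nvert T} \<and>
     (\<forall>t\<in>faces T. t \<subseteq> vertices T \<and> card t = 3 \<and> \<not> collinear t) \<and>
     triangulation ((\<lambda>t. convex hull t) ` faces T) \<and>
     vertices T = \<Union> (faces T) \<and>
     edges T = face_edges T"

text \<open>The four similar subtriangles: the set \<open>midpoint a ` t\<close> consists of the corner \<open>a\<close> and the
  mid-points of the two sides meeting there; the remaining triangle is spanned by the three mid-points.\<close>

definition split_face :: "(real^2) set \<Rightarrow> (real^2) set set" where
  "split_face t = insert {midpoint a b | a b. a \<in> t \<and> b \<in> t \<and> a \<noteq> b} ((\<lambda>a. midpoint a ` t) ` t)"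

text \<open>The numbering of the vertices of the refined mesh is left arbitrary.\<close>

definition is_refinement :: "mesh \<Rightarrow> mesh \<Rightarrow> bool" where
  "is_refinement T T' \<longleftrightarrow>
     inj_on (vert T') {1..nvert T'} \<and>
     vertices T' = vertices T \<union> {midpoint (vert T i) (vert T j) | i j. (i, j) \<in> edges T} \<and>
     faces T' = (\<Union>t\<in>faces T. split_face t) \<and>
     edges T' = face_edges T'"

text \<open>Below, \<open>T\<close> is the sequence of meshes, and the arguments \<open>k\<close>, \<open>l\<close> correspond to the superscript
  \<open>(k + 1, l)\<close>: the new vertex \<open>l\<close> belongs to \<open>T (Suc k)\<close>, the old vertices to \<open>T k\<close>.\<close>

definition radius :: "real \<Rightarrow> nat \<Rightarrow> real" where
  "radius L k = (1/2) ^ k * L"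

definition nbrs :: "real \<Rightarrow> (nat \<Rightarrow> mesh) \<Rightarrow> nat \<Rightarrow> nat \<Rightarrow> nat set" where
  "nbrs L T k l = {j \<in> {1..nvert (T k)}. norm (vert (T k) j - vert (T (Suc k)) l) < radius L k}"

definition weight ::
    "real \<Rightarrow> (real \<Rightarrow> real) \<Rightarrow> (nat \<Rightarrow> mesh) \<Rightarrow> nat \<Rightarrow> nat \<Rightarrow> nat \<Rightarrow> real" where
  "weight L W T k l i = W (norm (vert (T (Suc k)) l - vert (T k) i) / radius L k)"

definition Pi1 :: "(real^2 \<Rightarrow> real) set" where
  "Pi1 = {\<lambda>x. a + b * x$1 + c * x$2 | a b c. True}"

text \<open>For the refinements of a triangulation, with positive weights and \<open>L\<close> larger than every edge
  of \<open>T 0\<close>, each neighbourhood contains three non-collinear points, so the minimiser picked by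
  \<^const>\<open>arg_min\<close> exists and is unique.\<close>

definition wls_fit ::
    "real \<Rightarrow> (real \<Rightarrow> real) \<Rightarrow> (nat \<Rightarrow> mesh) \<Rightarrow> nat \<Rightarrow> nat \<Rightarrow> (nat \<Rightarrow> real) \<Rightarrow> (real^2 \<Rightarrow> real)" where
  "wls_fit L W T k l z =
     arg_min (\<lambda>p. \<Sum>i\<in>nbrs L T k l. weight L W T k l i * (p (vert (T k) i) - z i)\<^sup>2) (\<lambda>p. p \<in> Pi1)"

text \<open>The operator \<open>S\<^sup>k\<close>; only the values \<open>z i\<close> with \<open>i \<in> {1..nvert (T k)}\<close> matter, and only
  the indices \<open>l \<in> {1..nvert (T (Suc k))}\<close> of the result are meaningful.\<close>

definition wls_step ::
    "real \<Rightarrow> (real \<Rightarrow> real) \<Rightarrow> (nat \<Rightarrow> mesh) \<Rightarrow> nat \<Rightarrow> (nat \<Rightarrow> real) \<Rightarrow> (nat \<Rightarrow> real)" where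
  "wls_step L W T k z = (\<lambda>l. wls_fit L W T k l z (vert (T (Suc k)) l))"

definition area_det :: "real^2 \<Rightarrow> real^2 \<Rightarrow> real^2 \<Rightarrow> real" where
  "area_det p q r = det (vector [vector [1, 1, 1],
                                 vector [p$1, q$1, r$1],
                                 vector [p$2, q$2, r$2]] :: real^3^3)"

definition mu ::
    "real \<Rightarrow> (real \<Rightarrow> real) \<Rightarrow> (nat \<Rightarrow> mesh) \<Rightarrow> nat \<Rightarrow> nat \<Rightarrow> nat \<Rightarrow> real" where
  "mu L W T k l i =
     (\<Sum>(j1, j2) \<in> {(j1, j2). j1 \<in> nbrs L T k l \<and> j2 \<in> nbrs L T k l \<and> j1 < j2}.
        weight L W T k l j1 * weight L W T k l j2
        * area_det (vert (T (Suc k)) l) (vert (T k) j1) (vert (T k) j2)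
        * area_det (vert (T k) i) (vert (T k) j1) (vert (T k) j2))"

definition wls_coeff ::
    "real \<Rightarrow> (real \<Rightarrow> real) \<Rightarrow> (nat \<Rightarrow> mesh) \<Rightarrow> nat \<Rightarrow> nat \<Rightarrow> nat \<Rightarrow> real" where
  "wls_coeff L W T k l i =
     weight L W T k l i * mu L W T k l i
     / (\<Sum>j\<in>nbrs L T k l. weight L W T k l j * mu L W T k l j)"

end

theory Submission
  imports Defs
begin

text \<open>For fixed \<open>k\<close> and \<open>l\<close>, the function \<open>i \<mapsto> \<mu>\<^sub>i\<close> is, up to the constant \<open>\<Delta> = \<Sum>w\<^sub>j\<mu>\<^sub>j\<close>, the reproducing
  kernel of \<^const>\<open>Pi1\<close> for the weighted discrete inner product, taken at the new vertex. Since \<open>\<mu>\<^sub>i\<close> is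
  the value at the \<open>i\<close>-th node of an affine function, it is orthogonal to the residual of the least squares
  fit, so the fit at the new vertex is \<open>\<Sum>\<alpha>\<^sub>iz\<^sub>i\<close>; reproduction of constants gives \<open>\<Sum>\<alpha>\<^sub>i = 1\<close>. Here
  \<open>\<Delta> > 0\<close> because every new vertex is the mid-point of two (possibly equal) corners of a face of the old
  mesh, hence closer to all three corners of that face than its longest edge.

  In the first step independence gives the variance \<open>\<Sum>\<alpha>\<^sub>i\<^sup>2 \<cdot> Var X \<le> \<theta> \<cdot> Var X\<close>. Every later step takes
  convex combinations of centred variables, which by convexity of the square cannot increase the maximal
  variance, whatever the dependence between them.\<close>

section \<open>The reproducing kernel of weighted linear least squares\<close>

lemma area_det_eq: "area_det p q r = (q$1 - p$1) * (r$2 - p$2) - (r$1 - p$1) * (q$2 - p$2)"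
  by (simp add: area_det_def det_3 algebra_simps)

lemma area_det_perm:
  shows "area_det q r p = area_det p q r" and "area_det p r q = - area_det p q r"
  by (simp_all add: area_det_eq algebra_simps)

lemma area_det_refl [simp]: "area_det p q q = 0"
  by (simp add: area_det_eq)

lemma collinear_2D_line:
  fixes S :: "(real^2) set"
  assumes "b \<noteq> 0 \<or> c \<noteq> 0" and "\<And>x. x \<in> S \<Longrightarrow> a + b * x$1 + c * x$2 = 0"
  shows "collinear S"
proof -
  define n :: "real^2" where "n = vector [b, c]"
  have "n \<noteq> 0"
    using assms(1) by (auto simp: n_def vec_eq_iff forall_2)
  moreover have "S \<subseteq> {x. n \<bullet> x = - a}"
    using assms(2) by (fastforce simp: n_def inner_vec_def sum_2)
  ultimately have "aff_dim S \<le> 1"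
    using aff_dim_subset[of S "{x. n \<bullet> x = - a}"] by simp
  then show ?thesis
    by (simp add: collinear_aff_dim)
qed

text \<open>For fixed \<open>q\<close> and \<open>r\<close>, \<open>area_det x q r\<close> is an
  affine function of \<open>x\<close> that vanishes at \<open>q\<close> and \<open>r\<close>, with
  nonzero gradient since \<open>q\<close> and \<open>r\<close> differ. If it also vanished at
  \<open>p\<close>, its zero set would be a line through all three points.\<close>

lemma area_det_nonzero:
  assumes "\<not> collinear {p, q, r}"
  shows "area_det p q r \<noteq> 0"
proof
  assume 0: "area_det p q r = 0"
  have "q \<noteq> r"
    using assms by (auto simp: insert_commute)
  then have "q$2 - r$2 \<noteq> 0 \<or> r$1 - q$1 \<noteq> 0"
    by (auto simp: vec_eq_iff forall_2)
  moreover have "(q$1 * r$2 - r$1 * q$2) + (q$2 - r$2) * x$1 + (r$1 - q$1) * x$2 = 0"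
    if "x \<in> {p, q, r}" for x
    using that 0 by (auto simp: area_det_eq algebra_simps)
  ultimately have "collinear {p, q, r}"
    by (rule collinear_2D_line)
  with assms show False ..
qed

section \<open>The space of affine polynomials\<close>

lemma Pi1_add: "f \<in> Pi1 \<Longrightarrow> g \<in> Pi1 \<Longrightarrow> (\<lambda>x. f x + g x) \<in> Pi1"
  unfolding Pi1_def
proof clarsimp
  fix a b c a' b' c' :: real
  show "\<exists>a'' b'' c''. (\<lambda>x::real^2. a + b * x$1 + c * x$2 + (a' + b' * x$1 + c' * x$2)) =
      (\<lambda>x. a'' + b'' * x$1 + c'' * x$2)"
    by (intro exI[of _ "a + a'"] exI[of _ "b + b'"] exI[of _ "c + c'"]) (simp add: fun_eq_iff algebra_simps)
qed

lemma Pi1_scale: "f \<in> Pi1 \<Longrightarrow> (\<lambda>x. t * f x) \<in> Pi1"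
  unfolding Pi1_def
proof clarsimp
  fix a b c :: real
  show "\<exists>a' b' c'. (\<lambda>x::real^2. t * (a + b * x$1 + c * x$2)) = (\<lambda>x. a' + b' * x$1 + c' * x$2)"
    by (intro exI[of _ "t * a"] exI[of _ "t * b"] exI[of _ "t * c"]) (simp add: fun_eq_iff algebra_simps)
qed

lemma Pi1_const: "(\<lambda>x. a) \<in> Pi1"
  unfolding Pi1_def by (rule CollectI, intro exI[of _ a] exI[of _ 0]) simp

lemma Pi1_diff: "f \<in> Pi1 \<Longrightarrow> g \<in> Pi1 \<Longrightarrow> (\<lambda>x. f x - g x) \<in> Pi1"
  using Pi1_add[of f "\<lambda>x. -1 * g x"] Pi1_scale[of g "-1"] by simp

lemma Pi1_sum: "(\<And>i. i \<in> A \<Longrightarrow> f i \<in> Pi1) \<Longrightarrow> (\<lambda>x. \<Sum>i\<in>A. f i x) \<in> Pi1"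
  by (induction A rule: infinite_finite_induct) (auto simp: Pi1_const Pi1_add)

lemma Pi1_area_det: "(\<lambda>x. area_det x q r) \<in> Pi1"
  unfolding Pi1_def
  by (rule CollectI, rule exI[of _ "q$1 * r$2 - r$1 * q$2"], rule exI[of _ "q$2 - r$2"],
      rule exI[of _ "r$1 - q$1"]) (simp add: area_det_eq fun_eq_iff algebra_simps)

text \<open>Affine functions commute with barycentric combinations. The three determinants on the
  left are the barycentric coordinates of \<open>v\<close>, multiplied by
  \<open>area_det p q r\<close>; without the division the identity also covers degenerate
  triangles.\<close>

lemma Pi1_barycentric:
  assumes "f \<in> Pi1"
  shows "area_det v q r * f p + area_det v r p * f q + area_det v p q * f r = area_det p q r * f v"
  using assms by (auto simp: Pi1_def area_det_eq algebra_simps)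

text \<open>Up to the factor \<open>gram_det\<close>, which is the Gram determinant of the functions \<open>1, x\<^sub>1, x\<^sub>2\<close> (the sum
  over all triples counts each three-element set of nodes six times), \<open>lsq_kernel\<close> is the reproducing kernel of \<^const>\<open>Pi1\<close> with the inner product \<open>\<Sum>i\<in>B. w i * f (x i) * g (x i)\<close>.\<close>

definition lsq_kernel ::
    "'i::linorder set \<Rightarrow> ('i \<Rightarrow> real) \<Rightarrow> ('i \<Rightarrow> real^2) \<Rightarrow> real^2 \<Rightarrow> real^2 \<Rightarrow> real" where
  "lsq_kernel B w x p q =
     (\<Sum>(i, j) \<in> {(i, j). i \<in> B \<and> j \<in> B \<and> i < j}.
        w i * w j * area_det p (x i) (x j) * area_det q (x i) (x j))"

definition gram_det :: "'i set \<Rightarrow> ('i \<Rightarrow> real) \<Rightarrow> ('i \<Rightarrow> real^2) \<Rightarrow> real" where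
  "gram_det B w x = (\<Sum>h\<in>B. \<Sum>i\<in>B. \<Sum>j\<in>B. w h * w i * w j * (area_det (x h) (x i) (x j))\<^sup>2) / 6"

lemma lsq_kernel_commute: "lsq_kernel B w x p q = lsq_kernel B w x q p"
  by (simp add: lsq_kernel_def mult_ac)

lemma lsq_kernel_Pi1: "(\<lambda>p. lsq_kernel B w x p q) \<in> Pi1"
proof -
  have "(\<lambda>p. w i * w j * area_det p (x i) (x j) * area_det q (x i) (x j)) \<in> Pi1" for i j
    using Pi1_scale[OF Pi1_area_det[of "x i" "x j"], of "w i * w j * area_det q (x i) (x j)"]
    by (simp add: mult_ac)
  then show ?thesis
    unfolding lsq_kernel_def by (intro Pi1_sum) (auto split: prod.split)
qed

lemma sum_off_diagonal:
  fixes g :: "'i::linorder \<Rightarrow> 'i \<Rightarrow> real"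
  assumes "finite B" and sym: "\<And>i j. g i j = g j i" and diag: "\<And>i. g i i = 0"
  shows "(\<Sum>i\<in>B. \<Sum>j\<in>B. g i j) = 2 * (\<Sum>(i, j) \<in> {(i, j). i \<in> B \<and> j \<in> B \<and> i < j}. g i j)"
proof -
  let ?U = "{(i, j). i \<in> B \<and> j \<in> B \<and> i < j}" and ?D = "{(i, j). i \<in> B \<and> j \<in> B \<and> i = j}"
  have fin: "finite ?U" "finite ?D" "finite (prod.swap ` ?U)"
    using assms(1) by (auto intro: finite_subset[of _ "B \<times> B"])
  have split: "B \<times> B = (?U \<union> prod.swap ` ?U) \<union> ?D"
    by (auto simp: image_iff not_less_iff_gr_or_eq)
  have "(\<Sum>i\<in>B. \<Sum>j\<in>B. g i j) = (\<Sum>(i, j)\<in>B \<times> B. g i j)"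
    by (simp add: sum.cartesian_product)
  also have "\<dots> = (\<Sum>(i, j)\<in>?U. g i j) + (\<Sum>(i, j)\<in>prod.swap ` ?U. g i j) + (\<Sum>(i, j)\<in>?D. g i j)"
    unfolding split using fin by (subst sum.union_disjoint; (subst sum.union_disjoint)?) auto
  also have "(\<Sum>(i, j)\<in>?D. g i j) = 0"
    using diag by (intro sum.neutral) auto
  also have "(\<Sum>(i, j)\<in>prod.swap ` ?U. g i j) = (\<Sum>(i, j)\<in>?U. g i j)"
    by (subst sum.reindex) (auto intro!: sum.cong sym)
  finally show ?thesis by simp
qed

text \<open>Exchanging \<open>i\<close> and \<open>j\<close> flips the sign of both determinants, so
  the summand is symmetric. The full double sum allows the summation indices to be permuted
  freely.\<close>

lemma lsq_kernel_eq_double_sum: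
  assumes "finite B"
  shows "lsq_kernel B w x p q =
    (\<Sum>i\<in>B. \<Sum>j\<in>B. w i * w j * area_det p (x i) (x j) * area_det q (x i) (x j)) / 2"
proof -
  have sym: "w i * w j * area_det p (x i) (x j) * area_det q (x i) (x j) =
      w j * w i * area_det p (x j) (x i) * area_det q (x j) (x i)" for i j
    by (simp add: area_det_perm(2)[of _ "x i" "x j"])
  show ?thesis
    unfolding lsq_kernel_def by (subst sum_off_diagonal[OF assms sym]) auto
qed

text \<open>Averaging the triple sum over the three cyclic permutations of the summation indices turns the
  summand into the barycentric identity.\<close>

lemma lsq_kernel_reproducing:
  assumes "finite B" and "f \<in> Pi1"
  shows "(\<Sum>i\<in>B. w i * lsq_kernel B w x v (x i) * f (x i)) = gram_det B w x * f v"
proof -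
  define g where "g h i j = w h * w i * w j * area_det (x h) (x i) (x j) *
    (area_det v (x i) (x j) * f (x h))" for h i j
  let ?S = "\<lambda>g. \<Sum>h\<in>B. \<Sum>i\<in>B. \<Sum>j\<in>B. (g h i j :: real)"
  have rot: "?S g = ?S (\<lambda>h i j. g j h i)" for g
  proof -
    have "?S g = (\<Sum>i\<in>B. \<Sum>h\<in>B. \<Sum>j\<in>B. g h i j)"
      by (rule sum.swap)
    also have "\<dots> = (\<Sum>i\<in>B. \<Sum>j\<in>B. \<Sum>h\<in>B. g h i j)"
      by (intro sum.cong refl sum.swap)
    finally show ?thesis .
  qed
  \<comment> \<open>The 2 clears the half in the double-sum form of the kernel; adding the three
    rotated copies then gives the 6 of \<open>gram_det\<close>.\<close>
  have "2 * (\<Sum>i\<in>B. w i * lsq_kernel B w x v (x i) * f (x i)) = ?S g"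
    by (simp add: lsq_kernel_eq_double_sum[OF assms(1)] g_def sum_distrib_left sum_distrib_right
        mult_ac sum_divide_distrib)
  moreover have "?S g = ?S (\<lambda>h i j. g i j h)" "?S g = ?S (\<lambda>h i j. g j h i)"
    using rot[of g] rot[of "\<lambda>h i j. g j h i"] by simp_all
  ultimately have "6 * (\<Sum>i\<in>B. w i * lsq_kernel B w x v (x i) * f (x i)) =
      ?S (\<lambda>h i j. g h i j + g i j h + g j h i)"
    by (simp add: sum.distrib)
  also have "\<dots> = ?S (\<lambda>h i j. w h * w i * w j * (area_det (x h) (x i) (x j))\<^sup>2 * f v)"
  proof (intro sum.cong refl)
    fix h i j
    have "g h i j + g i j h + g j h i = w h * w i * w j * area_det (x h) (x i) (x j) *
      (area_det v (x i) (x j) * f (x h) + area_det v (x j) (x h) * f (x i) + area_det v (x h) (x i) * f (x j))"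
      using area_det_perm(1)[of "x i" "x j" "x h"] area_det_perm(1)[of "x j" "x h" "x i"]
      by (simp add: g_def algebra_simps)
    then show "g h i j + g i j h + g j h i = w h * w i * w j * (area_det (x h) (x i) (x j))\<^sup>2 * f v"
      by (simp add: Pi1_barycentric[OF assms(2)] power2_eq_square)
  qed
  also have "\<dots> = 6 * (gram_det B w x * f v)"
    by (simp add: gram_det_def sum_distrib_right)
  finally show ?thesis by simp
qed

text \<open>All summands are non-negative, and the one belonging to \<open>(a, b, c)\<close> is
  strictly positive; it is isolated one summation index at a time.\<close>

lemma gram_det_pos:
  assumes "finite B" and pos: "\<And>i. i \<in> B \<Longrightarrow> w i > 0"
    and "a \<in> B" "b \<in> B" "c \<in> B" and "\<not> collinear {x a, x b, x c}"
  shows "gram_det B w x > 0"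
proof -
  let ?g = "\<lambda>h i j. w h * w i * w j * (area_det (x h) (x i) (x j))\<^sup>2"
  have nonneg: "?g h i j \<ge> 0" if "h \<in> B" "i \<in> B" "j \<in> B" for h i j
    using pos that by (simp add: less_imp_le)
  have "0 < ?g a b c"
    using assms area_det_nonzero by (simp add: zero_less_mult_iff)
  also have "\<dots> \<le> (\<Sum>j\<in>B. ?g a b j)"
    using assms nonneg by (intro member_le_sum) auto
  also have "\<dots> \<le> (\<Sum>i\<in>B. \<Sum>j\<in>B. ?g a i j)"
    using assms nonneg by (intro member_le_sum[of b B "\<lambda>i. \<Sum>j\<in>B. ?g a i j"] sum_nonneg) auto
  also have "\<dots> \<le> (\<Sum>h\<in>B. \<Sum>i\<in>B. \<Sum>j\<in>B. ?g h i j)"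
    using assms nonneg
    by (intro member_le_sum[of a B "\<lambda>h. \<Sum>i\<in>B. \<Sum>j\<in>B. ?g h i j"] sum_nonneg) auto
  finally show ?thesis
    by (simp add: gram_det_def)
qed

section \<open>Existence and evaluation of the least squares fit\<close>

text \<open>Moving the minimizer by \<open>t * q\<close> changes the objective by a quadratic in
  \<open>t\<close> without constant term. It can be non-negative for all \<open>t\<close> only if
  its linear coefficient vanishes.\<close>

lemma lsq_normal_equations:
  assumes "finite B" and "p \<in> Pi1" "q \<in> Pi1"
    and min: "\<And>f. f \<in> Pi1 \<Longrightarrow>
      (\<Sum>i\<in>B. w i * (p (x i) - z i)\<^sup>2) \<le> (\<Sum>i\<in>B. w i * (f (x i) - z i)\<^sup>2)"
  shows "(\<Sum>i\<in>B. w i * (p (x i) - z i) * q (x i)) = 0"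
proof -
  define b where "b = (\<Sum>i\<in>B. w i * (p (x i) - z i) * q (x i))"
  define c where "c = (\<Sum>i\<in>B. w i * (q (x i))\<^sup>2)"
  have quad: "0 \<le> 2 * t * b + t\<^sup>2 * c" for t
  proof -
    have "(\<Sum>i\<in>B. w i * (p (x i) + t * q (x i) - z i)\<^sup>2) =
        (\<Sum>i\<in>B. w i * (p (x i) - z i)\<^sup>2) + (2 * t * b + t\<^sup>2 * c)"
      unfolding b_def c_def sum_distrib_left sum.distrib[symmetric]
      by (intro sum.cong refl) (simp add: power2_eq_square algebra_simps)
    with min[OF Pi1_add[OF assms(2) Pi1_scale[OF assms(3)]], of t] show ?thesis
      by simp
  qed
  show ?thesis
  proof (rule ccontr)
    assume "(\<Sum>i\<in>B. w i * (p (x i) - z i) * q (x i)) \<noteq> 0"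
    then have "b \<noteq> 0" by (simp add: b_def)
    \<comment> \<open>At \<open>t = - b / d\<close> the quadratic equals
      \<open>b^2 / d^2 * (c - 2 * d)\<close>. Taking \<open>d\<close> positive and larger than
      \<open>c\<close> makes this negative, also for \<open>c = 0\<close>.\<close>
    define d where "d = \<bar>c\<bar> + 1"
    have "d > 0" by (simp add: d_def)
    then have "2 * (- b / d) * b + (- b / d)\<^sup>2 * c = b\<^sup>2 / d\<^sup>2 * (c - 2 * d)"
      by (simp add: field_simps power2_eq_square)
    also have "\<dots> < 0"
      using \<open>b \<noteq> 0\<close> \<open>d > 0\<close> by (intro mult_pos_neg divide_pos_pos) (auto simp: d_def)
    finally show False
      using quad[of "- b / d"] by simp
  qed
qed

text \<open>The residual is orthogonal to the kernel, so the data in the kernel sum may be replaced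
  by the values of \<open>p\<close>, which the reproducing property evaluates. In particular all
  minimizers agree at every point.\<close>

lemma lsq_minimizer_eval:
  fixes w :: "'i::linorder \<Rightarrow> real"
  assumes "finite B" and "p \<in> Pi1" and "gram_det B w x \<noteq> 0"
    and "\<And>f. f \<in> Pi1 \<Longrightarrow>
      (\<Sum>i\<in>B. w i * (p (x i) - z i)\<^sup>2) \<le> (\<Sum>i\<in>B. w i * (f (x i) - z i)\<^sup>2)"
  shows "p v = (\<Sum>i\<in>B. w i * lsq_kernel B w x v (x i) * z i) / gram_det B w x"
proof -
  have "(\<lambda>q. lsq_kernel B w x v q) \<in> Pi1"
    using lsq_kernel_Pi1[of B w x v] by (simp add: lsq_kernel_commute)
  from lsq_normal_equations[OF assms(1,2) this, of w x z] assms(4)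
  have "(\<Sum>i\<in>B. w i * (p (x i) - z i) * lsq_kernel B w x v (x i)) = 0"
    by blast
  then have "(\<Sum>i\<in>B. w i * lsq_kernel B w x v (x i) * z i) =
      (\<Sum>i\<in>B. w i * lsq_kernel B w x v (x i) * p (x i))"
    by (simp add: algebra_simps sum_subtractf)
  also have "\<dots> = gram_det B w x * p v"
    by (rule lsq_kernel_reproducing[OF assms(1,2)])
  finally show ?thesis
    using assms(3) by simp
qed

lemma lsq_minimizer_exists:
  fixes w :: "'i::linorder \<Rightarrow> real"
  assumes "finite B" and "\<And>i. i \<in> B \<Longrightarrow> w i > 0" and ne: "gram_det B w x \<noteq> 0"
  obtains p where "p \<in> Pi1" and "\<And>f. f \<in> Pi1 \<Longrightarrow>
    (\<Sum>i\<in>B. w i * (p (x i) - z i)\<^sup>2) \<le> (\<Sum>i\<in>B. w i * (f (x i) - z i)\<^sup>2)"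
proof
  \<comment> \<open>The orthogonal projection of the data onto \<open>Pi1\<close>, written with the
    normalized reproducing kernel.\<close>
  define p where "p v = (\<Sum>i\<in>B. w i * z i / gram_det B w x * lsq_kernel B w x (x i) v)" for v
  show p: "p \<in> Pi1"
    unfolding p_def lsq_kernel_commute[of B w x "x _"] by (intro Pi1_sum Pi1_scale lsq_kernel_Pi1)
  fix f :: "real^2 \<Rightarrow> real" assume f: "f \<in> Pi1"
  define q where "q = (\<lambda>v. f v - p v)"
  have q: "q \<in> Pi1"
    unfolding q_def by (intro Pi1_diff f p)
  have "(\<Sum>i\<in>B. w i * p (x i) * q (x i)) =
      (\<Sum>i\<in>B. \<Sum>m\<in>B. w m * z m / gram_det B w x * (w i * lsq_kernel B w x (x m) (x i) * q (x i)))"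
    by (simp add: p_def sum_distrib_left sum_distrib_right mult_ac)
  also have "\<dots> = (\<Sum>m\<in>B. w m * z m / gram_det B w x *
      (\<Sum>i\<in>B. w i * lsq_kernel B w x (x m) (x i) * q (x i)))"
    by (subst sum.swap) (simp add: sum_distrib_left)
  also have "\<dots> = (\<Sum>m\<in>B. w m * z m * q (x m))"
    using ne by (simp add: lsq_kernel_reproducing[OF assms(1) q]) (simp add: mult_ac)
  finally have orth: "(\<Sum>i\<in>B. w i * (p (x i) - z i) * q (x i)) = 0"
    by (simp add: algebra_simps sum_subtractf)
  \<comment> \<open>Pythagoras: the cross term vanishes by orthogonality, so \<open>f\<close>
    exceeds \<open>p\<close> in the objective by the squared norm of \<open>q\<close>.\<close>
  have "(\<Sum>i\<in>B. w i * (f (x i) - z i)\<^sup>2) = (\<Sum>i\<in>B. w i * (p (x i) - z i)\<^sup>2) +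
      (2 * (\<Sum>i\<in>B. w i * (p (x i) - z i) * q (x i)) + (\<Sum>i\<in>B. w i * (q (x i))\<^sup>2))"
    unfolding sum_distrib_left sum.distrib[symmetric]
    by (intro sum.cong refl) (simp add: q_def power2_eq_square algebra_simps)
  moreover have "(\<Sum>i\<in>B. w i * (q (x i))\<^sup>2) \<ge> 0"
    using assms(2) by (intro sum_nonneg) (simp add: less_imp_le)
  ultimately show "(\<Sum>i\<in>B. w i * (p (x i) - z i)\<^sup>2) \<le> (\<Sum>i\<in>B. w i * (f (x i) - z i)\<^sup>2)"
    using orth by simp
qed

text \<open>\<open>arg_min\<close> selects an unspecified minimizer. One exists, and every minimizer
  has the stated value at \<open>v\<close>, so the choice does not affect the result.\<close>

lemma lsq_arg_min_eval:
  fixes w :: "'i::linorder \<Rightarrow> real"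
  assumes "finite B" and "\<And>i. i \<in> B \<Longrightarrow> w i > 0" and "gram_det B w x \<noteq> 0"
  shows "arg_min (\<lambda>p. \<Sum>i\<in>B. w i * (p (x i) - z i)\<^sup>2) (\<lambda>p. p \<in> Pi1) v =
    (\<Sum>i\<in>B. w i * lsq_kernel B w x v (x i) * z i) / gram_det B w x"
proof -
  obtain p where p: "p \<in> Pi1" and min: "\<And>f. f \<in> Pi1 \<Longrightarrow>
      (\<Sum>i\<in>B. w i * (p (x i) - z i)\<^sup>2) \<le> (\<Sum>i\<in>B. w i * (f (x i) - z i)\<^sup>2)"
    using lsq_minimizer_exists[OF assms] by blast
  show ?thesis
  proof (rule arg_minI[where P = "\<lambda>p. p \<in> Pi1" and Q = "\<lambda>p. p v = _", OF p])
    show "\<not> (\<Sum>i\<in>B. w i * (f (x i) - z i)\<^sup>2) < (\<Sum>i\<in>B. w i * (p (x i) - z i)\<^sup>2)"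
      if "f \<in> Pi1" for f
      using min[OF that] by (simp only: not_less)
  next
    fix f assume "f \<in> Pi1" "\<forall>g. g \<in> Pi1 \<longrightarrow>
      \<not> (\<Sum>i\<in>B. w i * (g (x i) - z i)\<^sup>2) < (\<Sum>i\<in>B. w i * (f (x i) - z i)\<^sup>2)"
    then show "f v = (\<Sum>i\<in>B. w i * lsq_kernel B w x v (x i) * z i) / gram_det B w x"
      by (intro lsq_minimizer_eval[OF assms(1) _ assms(3)]) (simp_all add: not_less)
  qed
qed

section \<open>The subdivision step as an affine combination\<close>

lemma wls_step_eq:
  assumes pos: "\<And>i. i \<in> nbrs L T k l \<Longrightarrow> weight L W T k l i > 0"
    and abc: "a \<in> nbrs L T k l" "b \<in> nbrs L T k l" "c \<in> nbrs L T k l"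
    and ncol: "\<not> collinear {vert (T k) a, vert (T k) b, vert (T k) c}"
  shows "wls_step L W T k z l = (\<Sum>i\<in>nbrs L T k l. wls_coeff L W T k l i * z i)"
    and "(\<Sum>i\<in>nbrs L T k l. wls_coeff L W T k l i) = 1"
proof -
  let ?B = "nbrs L T k l" and ?w = "weight L W T k l" and ?x = "vert (T k)"
  let ?K = "lsq_kernel ?B ?w ?x (vert (T (Suc k)) l)"
  have fin: "finite ?B"
    by (simp add: nbrs_def)
  have ne: "gram_det ?B ?w ?x \<noteq> 0"
    using gram_det_pos[where w = ?w and x = ?x, OF fin pos abc ncol] by simp
  have mu: "mu L W T k l i = ?K (?x i)" for i
    by (simp add: mu_def lsq_kernel_def)
  \<comment> \<open>Reproducing the constant 1 identifies the denominator of
    \<open>wls_coeff\<close> with the Gram determinant.\<close>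
  have gram: "(\<Sum>j\<in>?B. ?w j * ?K (?x j)) = gram_det ?B ?w ?x"
    using lsq_kernel_reproducing[OF fin Pi1_const[of 1]] by simp
  show "wls_step L W T k z l = (\<Sum>i\<in>?B. wls_coeff L W T k l i * z i)"
    using lsq_arg_min_eval[OF fin pos ne]
    by (simp add: wls_step_def wls_fit_def wls_coeff_def mu gram sum_divide_distrib)
  show "(\<Sum>i\<in>?B. wls_coeff L W T k l i) = 1"
    using ne by (simp add: wls_coeff_def mu gram flip: sum_divide_distrib)
qed

section \<open>Faces of the refined meshes\<close>

text \<open>The invariant carried along the refinements. Its scale \<open>r\<close> bounds all
  distances within a face and is halved in every step, in parallel with
  \<open>radius\<close>.\<close>

definition shape_regular :: "real \<Rightarrow> mesh \<Rightarrow> bool" where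
  "shape_regular r T \<longleftrightarrow>
     (\<forall>t\<in>faces T. t \<subseteq> vertices T \<and> card t = 3 \<and> \<not> collinear t \<and> (\<forall>a\<in>t. \<forall>b\<in>t. norm (a - b) < r)) \<and>
     vertices T = \<Union> (faces T) \<and>
     edges T = face_edges T"

lemma face_edgesI:
  assumes "t \<in> faces T" "t \<subseteq> vertices T" "x \<in> t" "y \<in> t" "x \<noteq> y"
  obtains i j where "(i, j) \<in> face_edges T" "x = vert T i" "y = vert T j"
proof -
  have "x \<in> vertices T" "y \<in> vertices T"
    using assms by blast+
  then obtain i j where ij: "i \<in> {1..nvert T}" "x = vert T i" "j \<in> {1..nvert T}" "y = vert T j"
    unfolding vertices_def by (elim imageE)
  then have "i \<noteq> j"
    using \<open>x \<noteq> y\<close> by metis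
  then have "(i, j) \<in> face_edges T"
    using ij assms unfolding face_edges_def by simp metis
  with ij that show thesis by metis
qed

text \<open>Every side of a face is an edge, so the bound on edge lengths is a bound on the
  diameters of the faces.\<close>

lemma shape_regular_triangulation:
  assumes T: "is_triangulation T"
    and L: "L > Sup {norm (vert T i - vert T j) | i j. (i, j) \<in> edges T}"
  shows "shape_regular L T"
proof -
  have mesh: "\<And>t. t \<in> faces T \<Longrightarrow> t \<subseteq> vertices T \<and> card t = 3 \<and> \<not> collinear t"
    and vertices: "vertices T = \<Union> (faces T)" and edges: "edges T = face_edges T"
    using T unfolding is_triangulation_def by (blast, simp, simp)
  have edge: "norm (a - b) < L" if t: "t \<in> faces T" "a \<in> t" "b \<in> t" and "a \<noteq> b" for t a b
  proof -
    have "t \<subseteq> vertices T"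
      using mesh t(1) by blast
    then obtain i j where "(i, j) \<in> face_edges T" and ab: "a = vert T i" "b = vert T j"
      by (rule face_edgesI[OF t(1) _ t(2,3) \<open>a \<noteq> b\<close>])
    then have "(i, j) \<in> edges T"
      by (simp add: edges)
    \<comment> \<open>A real \<open>Sup\<close> is known to be an upper bound only for a set that is
      bounded above; finiteness of the edge set supplies this.\<close>
    moreover have "finite (edges T)"
      by (rule finite_subset[of _ "{1..nvert T} \<times> {1..nvert T}"]) (auto simp: edges face_edges_def)
    then have "finite ((\<lambda>(i, j). norm (vert T i - vert T j)) ` edges T)"
      by blast
    then have "bdd_above {norm (vert T i - vert T j) | i j. (i, j) \<in> edges T}"
      by (rule bdd_above_mono[OF bdd_above_finite]) auto
    ultimately have "norm (vert T i - vert T j) \<le> Sup {norm (vert T i - vert T j) | i j. (i, j) \<in> edges T}"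
      by (intro cSup_upper) blast
    with L ab show ?thesis by simp
  qed
  have "norm (a - b) < L" if t: "t \<in> faces T" "a \<in> t" "b \<in> t" for t a b
  proof (cases "a = b")
    \<comment> \<open>Here the claim is \<open>0 < L\<close>, which follows from the length of a
      proper side of \<open>t\<close>.\<close>
    case True
    have "card t = 3"
      using mesh t(1) by blast
    then obtain u v where "u \<in> t" "v \<in> t" "u \<noteq> v"
      unfolding card_3_iff by blast
    then obtain c where "c \<in> t" "a \<noteq> c"
      by blast
    then have "norm (a - c) < L"
      by (rule edge[OF t(1,2)])
    with True show ?thesis
      using le_less_trans[OF norm_ge_zero] by simp
  qed (rule edge[OF t])
  then show ?thesis
    unfolding shape_regular_def using mesh vertices edges by blast
qed

text \<open>A corner triangle is the image of \<open>t\<close> under the homothety with factor 1/2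
  centred at that corner. The middle triangle is the image under the homothety with factor -1/2
  centred at the centroid, which sends each corner to the mid-point of the opposite side.\<close>

lemma split_face_homothetic:
  assumes "card t = 3" "s \<in> split_face t"
  obtains p c where "s = (\<lambda>x. p + c *\<^sub>R x) ` t" "\<bar>c\<bar> = 1/2"
proof -
  obtain u v w where t: "t = {u, v, w}" "u \<noteq> v" "u \<noteq> w" "v \<noteq> w"
    using assms(1) by (auto simp: card_3_iff)
  consider a where "s = midpoint a ` t" | "s = {midpoint a b | a b. a \<in> t \<and> b \<in> t \<and> a \<noteq> b}"
    using assms(2) by (auto simp: split_face_def)
  then show thesis
  proof cases
    case 1
    have "midpoint a = (\<lambda>x. (1/2) *\<^sub>R a + (1/2) *\<^sub>R x)"
      by (simp add: fun_eq_iff midpoint_def algebra_simps)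
    with 1 show thesis
      using that[of "(1/2) *\<^sub>R a" "1/2"] by simp
  next
    case 2
    let ?f = "\<lambda>x. (1/2) *\<^sub>R (u + v + w) + (- 1/2) *\<^sub>R x"
    have f: "?f x = midpoint y z" if "u + v + w = x + y + z" for x y z
      using that by (subst eq_commute) (simp add: midpoint_eq_iff scaleR_right_distrib flip: scaleR_2)
    have "s = {midpoint v w, midpoint u w, midpoint u v}"
      unfolding 2 t(1) using t(2-4) by (auto simp: midpoint_sym)
    also have "\<dots> = {?f u, ?f v, ?f w}"
      by (subst (1 2 3) f) (simp_all add: add_ac)
    also have "\<dots> = ?f ` t"
      by (simp add: t(1))
    finally show thesis
      using that[of "(1/2) *\<^sub>R (u + v + w)" "- 1/2"] by simp
  qed
qed

lemma collinear_homothetic: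
  assumes "collinear ((\<lambda>x. p + c *\<^sub>R x) ` t)" "c \<noteq> 0"
  shows "collinear t"
proof -
  obtain u where u: "\<And>x y. x \<in> t \<Longrightarrow> y \<in> t \<Longrightarrow> \<exists>d. c *\<^sub>R x - c *\<^sub>R y = d *\<^sub>R u"
    using assms(1) by (auto simp: collinear_def)
  have "\<exists>d. x - y = d *\<^sub>R u" if xy: "x \<in> t" "y \<in> t" for x y
  proof -
    obtain d where "c *\<^sub>R x - c *\<^sub>R y = d *\<^sub>R u"
      using u xy by blast
    then have "(1/c) *\<^sub>R (c *\<^sub>R x - c *\<^sub>R y) = (1/c) *\<^sub>R (d *\<^sub>R u)"
      by simp
    then show ?thesis
      using assms(2) by (auto simp: scaleR_diff_right)
  qed
  then show ?thesis
    by (auto simp: collinear_def)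
qed

text \<open>Old vertices are the case \<open>x = y\<close>, since each lies in a face; edge
  mid-points are the case of distinct \<open>x\<close> and \<open>y\<close>, since edges are exactly
  the sides of faces.\<close>

lemma vertices_refinement:
  assumes T: "shape_regular r T" and T': "is_refinement T T'"
  shows "v \<in> vertices T' \<longleftrightarrow> (\<exists>t\<in>faces T. \<exists>x\<in>t. \<exists>y\<in>t. v = midpoint x y)"
proof -
  have new: "vertices T' = vertices T \<union> {midpoint (vert T i) (vert T j) | i j. (i, j) \<in> edges T}"
    using T' unfolding is_refinement_def by (elim conjE)
  have vertices: "vertices T = \<Union> (faces T)" and edges: "edges T = face_edges T"
    using T by (simp_all add: shape_regular_def)
  show ?thesis
  proof
    assume "v \<in> vertices T'"
    then consider "v \<in> vertices T"
      | i j where "(i, j) \<in> face_edges T" "v = midpoint (vert T i) (vert T j)"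
      unfolding new edges by blast
    then show "\<exists>t\<in>faces T. \<exists>x\<in>t. \<exists>y\<in>t. v = midpoint x y"
    proof cases
      case 1
      then obtain t where "t \<in> faces T" "v \<in> t"
        unfolding vertices by (elim UnionE)
      then show ?thesis
        using midpoint_idem[of v] by metis
    next
      case 2
      then obtain t where "t \<in> faces T" "vert T i \<in> t" "vert T j \<in> t"
        by (auto simp: face_edges_def)
      with 2(2) show ?thesis by metis
    qed
  next
    assume "\<exists>t\<in>faces T. \<exists>x\<in>t. \<exists>y\<in>t. v = midpoint x y"
    then obtain t x y where t: "t \<in> faces T" "x \<in> t" "y \<in> t" and v: "v = midpoint x y"
      by (elim bexE)
    have sub: "t \<subseteq> vertices T"
      using t(1) unfolding vertices by (rule Union_upper)
    show "v \<in> vertices T'"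
    proof (cases "x = y")
      case True
      then have "v \<in> vertices T"
        using sub t(2) v by (simp add: subsetD)
      then show ?thesis by (simp add: new)
    next
      case False
      obtain i j where ij: "(i, j) \<in> face_edges T" "x = vert T i" "y = vert T j"
        by (rule face_edgesI[OF t(1) sub t(2,3) False])
      show ?thesis
        unfolding new edges v ij(2,3) using ij(1) by (intro UnI2 CollectI exI conjI) (rule refl)
    qed
  qed
qed

text \<open>Each new face is a homothetic copy of an old one at half scale, which preserves
  non-degeneracy and halves the distances.\<close>

lemma shape_regular_refinement:
  assumes T: "shape_regular r T" and T': "is_refinement T T'"
  shows "shape_regular (r / 2) T'"
proof -
  have sub: "\<exists>x\<in>t. \<exists>y\<in>t. v = midpoint x y" if "s \<in> split_face t" "v \<in> s" for s t v
    using that unfolding split_face_def by auto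
  have face: "s \<subseteq> vertices T' \<and> card s = 3 \<and> \<not> collinear s \<and> (\<forall>a\<in>s. \<forall>b\<in>s. norm (a - b) < r / 2)"
    if s: "s \<in> split_face t" and t: "t \<in> faces T" for s t
  proof -
    have reg: "card t = 3" "\<not> collinear t" "\<And>a b. a \<in> t \<Longrightarrow> b \<in> t \<Longrightarrow> norm (a - b) < r"
      using T t unfolding shape_regular_def by blast+
    obtain p c where pc: "s = (\<lambda>x. p + c *\<^sub>R x) ` t" "\<bar>c\<bar> = 1/2"
      using split_face_homothetic[OF reg(1) s] .
    then have "c \<noteq> 0" by auto
    have "s \<subseteq> vertices T'"
      using sub[OF s] t vertices_refinement[OF assms] by (intro subsetI) metis
    moreover have "card s = 3"
      using reg(1) \<open>c \<noteq> 0\<close> unfolding pc(1) by (subst card_image) (auto simp: inj_on_def)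
    moreover have "\<not> collinear s"
      using collinear_homothetic[of p c t] reg(2) \<open>c \<noteq> 0\<close> unfolding pc(1) by blast
    moreover have "norm (a - b) < r / 2" if "a \<in> s" "b \<in> s" for a b
    proof -
      obtain x y where xy: "x \<in> t" "y \<in> t" "a = p + c *\<^sub>R x" "b = p + c *\<^sub>R y"
        using \<open>a \<in> s\<close> \<open>b \<in> s\<close> unfolding pc(1) by (elim imageE) simp
      then have "norm (a - b) = norm (x - y) / 2"
        using pc(2) by (simp flip: scaleR_diff_right)
      with reg(3)[OF xy(1,2)] show ?thesis by simp
    qed
    ultimately show ?thesis by blast
  qed
  have T'_eqs: "faces T' = (\<Union>t\<in>faces T. split_face t)" "edges T' = face_edges T'"
    using T' by (simp_all add: is_refinement_def)
  have "vertices T' \<subseteq> \<Union> (faces T')"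
  proof
    fix v assume "v \<in> vertices T'"
    then obtain x y t where "t \<in> faces T" "x \<in> t" "y \<in> t" "v = midpoint x y"
      unfolding vertices_refinement[OF assms] by (elim bexE)
    \<comment> \<open>The corner triangle at \<open>x\<close> contains \<open>midpoint x y\<close>,
      also for \<open>x = y\<close>.\<close>
    then have "midpoint x ` t \<in> faces T'" "v \<in> midpoint x ` t"
      by (simp_all add: T'_eqs(1) split_face_def) (rule bexI[of _ t], simp_all)
    then show "v \<in> \<Union> (faces T')" by (rule UnionI)
  qed
  moreover have "\<Union> (faces T') \<subseteq> vertices T'"
    using face unfolding T'_eqs(1) by blast
  ultimately have "vertices T' = \<Union> (faces T')" ..
  moreover have "s \<subseteq> vertices T' \<and> card s = 3 \<and> \<not> collinear s \<and> (\<forall>a\<in>s. \<forall>b\<in>s. norm (a - b) < r / 2)"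
    if "s \<in> faces T'" for s
    using that face unfolding T'_eqs(1) by blast
  ultimately show ?thesis
    unfolding shape_regular_def using T'_eqs(2) by blast
qed

lemma shape_regular_iterate:
  assumes "shape_regular L (T 0)" and "\<And>k. is_refinement (T k) (T (Suc k))"
  shows "shape_regular (radius L k) (T k)"
proof (induction k)
  case 0
  then show ?case using assms(1) by (simp add: radius_def)
next
  case (Suc k)
  then show ?case
    using shape_regular_refinement[OF Suc assms(2)] by (simp add: radius_def)
qed

section \<open>Neighbourhoods and weights along the refinements\<close>

lemma nbrs_not_collinear:
  assumes T: "shape_regular (radius L k) (T k)" and T': "is_refinement (T k) (T (Suc k))"
    and l: "l \<in> {1..nvert (T (Suc k))}"
  obtains a b c where "a \<in> nbrs L T k l" "b \<in> nbrs L T k l" "c \<in> nbrs L T k l"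
    "\<not> collinear {vert (T k) a, vert (T k) b, vert (T k) c}"
proof -
  let ?v = "vert (T (Suc k)) l"
  have "?v \<in> vertices (T (Suc k))"
    using l by (simp add: vertices_def)
  then obtain x y t where t: "t \<in> faces (T k)" "x \<in> t" "y \<in> t" "?v = midpoint x y"
    unfolding vertices_refinement[OF T T'] by (elim bexE)
  have reg: "card t = 3" "\<not> collinear t" "t \<subseteq> vertices (T k)"
      "\<And>a b. a \<in> t \<Longrightarrow> b \<in> t \<Longrightarrow> norm (a - b) < radius L k"
    using T t(1) unfolding shape_regular_def by blast+
  have near: "\<exists>i\<in>nbrs L T k l. vert (T k) i = z" if z: "z \<in> t" for z
  proof -
    have "?v + ?v = x + y"
      by (simp add: t(4))
    \<comment> \<open>Since the new vertex is the mid-point of \<open>x\<close> and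
      \<open>y\<close>, its offset from a corner \<open>z\<close> is the mean of two differences of
      corners, each shorter than the radius.\<close>
    then have "2 *\<^sub>R (z - ?v) = (z - x) + (z - y)"
      unfolding scaleR_2 by (simp add: algebra_simps)
    then have "norm (2 *\<^sub>R (z - ?v)) = norm ((z - x) + (z - y))"
      by (rule arg_cong)
    then have "norm (z - ?v) = norm ((z - x) + (z - y)) / 2"
      by simp
    also have "\<dots> \<le> (norm (z - x) + norm (z - y)) / 2"
      using norm_triangle_ineq[of "z - x" "z - y"] by simp
    also have "\<dots> < radius L k"
      using reg(4)[OF z t(2)] reg(4)[OF z t(3)] by simp
    finally have "norm (z - ?v) < radius L k" .
    moreover obtain i where "i \<in> {1..nvert (T k)}" "vert (T k) i = z"
      using reg(3) z unfolding vertices_def by blast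
    ultimately show ?thesis
      by (auto simp: nbrs_def)
  qed
  obtain u v w where uvw: "t = {u, v, w}"
    using reg(1) unfolding card_3_iff by (elim exE conjE)
  obtain a where a: "a \<in> nbrs L T k l" "vert (T k) a = u"
    using near[of u] uvw by (auto simp: Bex_def)
  obtain b where b: "b \<in> nbrs L T k l" "vert (T k) b = v"
    using near[of v] uvw by (auto simp: Bex_def)
  obtain c where c: "c \<in> nbrs L T k l" "vert (T k) c = w"
    using near[of w] uvw by (auto simp: Bex_def)
  show thesis
    by (rule that[OF a(1) b(1) c(1)]) (use reg(2) in \<open>simp add: a b c uvw\<close>)
qed

text \<open>\<open>W\<close> is controlled only on the half-open unit interval. The strict
  inequality in \<open>nbrs\<close> puts the scaled distance there and forces the radius to be
  positive.\<close>

lemma weight_pos: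
  assumes "W \<in> {0..<1} \<rightarrow> {0<..1}" "i \<in> nbrs L T k l"
  shows "weight L W T k l i > 0"
proof -
  have *: "norm (vert (T (Suc k)) l - vert (T k) i) < radius L k"
    using assms(2) by (simp add: nbrs_def norm_minus_commute)
  then have "0 < radius L k"
    by (rule le_less_trans[OF norm_ge_zero])
  with * have "norm (vert (T (Suc k)) l - vert (T k) i) / radius L k \<in> {0..<1}"
    by simp
  with assms(1) show ?thesis
    unfolding weight_def by fastforce
qed

lemma wls_step_refinement:
  assumes "shape_regular L (T 0)" and Tk: "\<And>k. is_refinement (T k) (T (Suc k))"
    and W: "W \<in> {0..<1} \<rightarrow> {0<..1}" and l: "l \<in> {1..nvert (T (Suc k))}"
  shows "wls_step L W T k z l = (\<Sum>i\<in>nbrs L T k l. wls_coeff L W T k l i * z i)"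
    and "(\<Sum>i\<in>nbrs L T k l. wls_coeff L W T k l i) = 1"
proof -
  obtain a b c where "a \<in> nbrs L T k l" "b \<in> nbrs L T k l" "c \<in> nbrs L T k l"
    "\<not> collinear {vert (T k) a, vert (T k) b, vert (T k) c}"
    using nbrs_not_collinear[OF shape_regular_iterate[of L T, OF assms(1) Tk] Tk l] .
  from wls_step_eq[OF weight_pos[OF W] this]
  show "wls_step L W T k z l = (\<Sum>i\<in>nbrs L T k l. wls_coeff L W T k l i * z i)"
    and "(\<Sum>i\<in>nbrs L T k l. wls_coeff L W T k l i) = 1"
    by blast+
qed

section \<open>Variance of linear combinations\<close>

text \<open>Jensen's inequality for the square.\<close>

lemma square_sum_convex:
  fixes a y :: "'i \<Rightarrow> real"
  assumes "finite B" "\<And>i. i \<in> B \<Longrightarrow> a i \<ge> 0" "(\<Sum>i\<in>B. a i) = 1"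
  shows "(\<Sum>i\<in>B. a i * y i)\<^sup>2 \<le> (\<Sum>i\<in>B. a i * (y i)\<^sup>2)"
proof -
  have "B \<noteq> {}"
    using assms(3) by auto
  then show ?thesis
    using convex_on_sum[OF assms(1) _ convex_power2, of a y] assms(2,3) by simp
qed

context prob_space
begin

text \<open>For such variables the variance is the second moment. Integrability is carried along
  because the integral of a non-integrable function is 0 by convention, so a bound on it alone would
  say nothing.\<close>

definition centred_L2 :: "('a \<Rightarrow> real) \<Rightarrow> bool" where
  "centred_L2 Y \<longleftrightarrow> Y \<in> borel_measurable M \<and> integrable M (\<lambda>\<omega>. (Y \<omega>)\<^sup>2) \<and> expectation Y = 0"

lemma variance_centred_L2: "centred_L2 Y \<Longrightarrow> variance Y = expectation (\<lambda>\<omega>. (Y \<omega>)\<^sup>2)"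
  by (simp add: centred_L2_def)

lemma centred_L2_integrable: "centred_L2 Y \<Longrightarrow> integrable M Y"
  by (simp add: centred_L2_def square_integrable_imp_integrable)

text \<open>Jensen's inequality is applied at each sample point. It dominates the square of
  \<open>Y\<close> by an integrable function, which gives square-integrability, and integrating it
  gives the variance bound.\<close>

lemma convex_combination_centred_L2:
  assumes B: "finite B" "\<And>i. i \<in> B \<Longrightarrow> a i \<ge> 0" "(\<Sum>i\<in>B. a i) = 1"
    and e: "\<And>i. i \<in> B \<Longrightarrow> centred_L2 (e i)"
    and Y: "\<And>\<omega>. \<omega> \<in> space M \<Longrightarrow> Y \<omega> = (\<Sum>i\<in>B. a i * e i \<omega>)"
  shows "centred_L2 Y" and "variance Y \<le> (\<Sum>i\<in>B. a i * variance (e i))"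
proof -
  have e_meas: "e i \<in> borel_measurable M" if "i \<in> B" for i
    using e[OF that] by (simp add: centred_L2_def)
  have e2: "integrable M (\<lambda>\<omega>. (e i \<omega>)\<^sup>2)" if "i \<in> B" for i
    using e[OF that] by (simp add: centred_L2_def)
  have "(\<lambda>\<omega>. \<Sum>i\<in>B. a i * e i \<omega>) \<in> borel_measurable M"
    using e_meas by measurable
  then have meas: "Y \<in> borel_measurable M"
    using Y by (simp cong: measurable_cong)
  have bound: "integrable M (\<lambda>\<omega>. \<Sum>i\<in>B. a i * (e i \<omega>)\<^sup>2)"
    using e2 by (intro Bochner_Integration.integrable_sum integrable_mult_right) auto
  have le: "(Y \<omega>)\<^sup>2 \<le> (\<Sum>i\<in>B. a i * (e i \<omega>)\<^sup>2)" if "\<omega> \<in> space M" for \<omega>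
    using square_sum_convex[OF B, of "\<lambda>i. e i \<omega>"] by (simp add: Y[OF that])
  have int: "integrable M (\<lambda>\<omega>. (Y \<omega>)\<^sup>2)"
  proof (rule Bochner_Integration.integrable_bound[OF bound])
    show "AE \<omega> in M. norm ((Y \<omega>)\<^sup>2) \<le> norm (\<Sum>i\<in>B. a i * (e i \<omega>)\<^sup>2)"
    proof (rule AE_I2)
      fix \<omega> assume "\<omega> \<in> space M"
      from le[OF this] show "norm ((Y \<omega>)\<^sup>2) \<le> norm (\<Sum>i\<in>B. a i * (e i \<omega>)\<^sup>2)"
        by simp
    qed
  qed (use meas in measurable)
  have "expectation Y = expectation (\<lambda>\<omega>. \<Sum>i\<in>B. a i * e i \<omega>)"
    by (intro Bochner_Integration.integral_cong refl Y)
  also have "\<dots> = (\<Sum>i\<in>B. a i * expectation (e i))"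
    using centred_L2_integrable[OF e] by (subst Bochner_Integration.integral_sum) auto
  also have "\<dots> = 0"
    using e by (simp add: centred_L2_def)
  finally show cY: "centred_L2 Y"
    using meas int by (simp add: centred_L2_def)
  have "expectation (\<lambda>\<omega>. (Y \<omega>)\<^sup>2) \<le> expectation (\<lambda>\<omega>. \<Sum>i\<in>B. a i * (e i \<omega>)\<^sup>2)"
    by (intro integral_mono int bound le)
  also have "\<dots> = (\<Sum>i\<in>B. a i * expectation (\<lambda>\<omega>. (e i \<omega>)\<^sup>2))"
    using e2 by (subst Bochner_Integration.integral_sum) auto
  finally show "variance Y \<le> (\<Sum>i\<in>B. a i * variance (e i))"
    using variance_centred_L2[OF cY] variance_centred_L2[OF e] by simp
qed

lemma indep_vars_pair:
  fixes X :: "'i \<Rightarrow> 'a \<Rightarrow> real"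
  assumes "indep_vars (\<lambda>_. borel) X I" "i \<in> I" "j \<in> I" "i \<noteq> j"
  shows "indep_var borel (X i) borel (X j)"
  \<comment> \<open>Independence of \<open>X i\<close> from a sum of other variables, taken for the
    sum with the single term \<open>X j\<close>.\<close>
  using indep_vars_sum[of "{j}" i X] indep_vars_subset[OF assms(1), of "{i, j}"] assms(2-) by simp

text \<open>In the expanded square, the expectation of a mixed product factorizes by independence
  into a product of zero means; only the diagonal survives.\<close>

lemma expectation_square_indep_sum:
  fixes e :: "'i \<Rightarrow> 'a \<Rightarrow> real"
  assumes ind: "indep_vars (\<lambda>_. borel) e I" and B: "finite B" "B \<subseteq> I"
    and e: "\<And>i. i \<in> B \<Longrightarrow> centred_L2 (e i)"
  shows "expectation (\<lambda>\<omega>. (\<Sum>i\<in>B. a i * e i \<omega>)\<^sup>2) = (\<Sum>i\<in>B. (a i)\<^sup>2 * variance (e i))"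
proof -
  have pair: "integrable M (\<lambda>\<omega>. e i \<omega> * e j \<omega>) \<and>
      expectation (\<lambda>\<omega>. e i \<omega> * e j \<omega>) = (if i = j then variance (e i) else 0)"
    if ij: "i \<in> B" "j \<in> B" for i j
  proof (cases "i = j")
    case True
    then show ?thesis
      using e[OF ij(1)] variance_centred_L2[OF e[OF ij(1)]]
      by (simp add: centred_L2_def power2_eq_square)
  next
    case False
    have "indep_var borel (e i) borel (e j)"
      using indep_vars_pair[OF ind _ _ False] B(2) ij by blast
    with False e ij show ?thesis
      by (simp add: indep_var_integrable indep_var_lebesgue_integral centred_L2_integrable)
        (simp add: centred_L2_def)
  qed
  have "expectation (\<lambda>\<omega>. (\<Sum>i\<in>B. a i * e i \<omega>)\<^sup>2) =
      expectation (\<lambda>\<omega>. \<Sum>i\<in>B. \<Sum>j\<in>B. a i * a j * (e i \<omega> * e j \<omega>))"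
    by (simp add: power2_eq_square sum_product mult_ac)
  also have "\<dots> = (\<Sum>i\<in>B. \<Sum>j\<in>B. a i * a j * expectation (\<lambda>\<omega>. e i \<omega> * e j \<omega>))"
    using pair by (simp add: Bochner_Integration.integral_sum)
  also have "\<dots> = (\<Sum>i\<in>B. \<Sum>j\<in>B. if i = j then (a i)\<^sup>2 * variance (e i) else 0)"
    using pair by (intro sum.cong refl) (simp add: power2_eq_square)
  also have "\<dots> = (\<Sum>i\<in>B. (a i)\<^sup>2 * variance (e i))"
    using B(1) by simp
  finally show ?thesis .
qed

end

section \<open>Transfer between probability spaces and the variance bound\<close>

text \<open>The noise and \<open>X\<close> may live on different spaces. Mean and second moment are
  integrals against the common law on the real line, so they carry over.\<close>

lemma centred_L2_cong_distr:
  assumes "prob_space M" "prob_space M'" "prob_space.centred_L2 M' X"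
    and Y: "Y \<in> borel_measurable M" and eq: "distr M borel Y = distr M' borel X"
  shows "prob_space.centred_L2 M Y" and "prob_space.variance M Y = prob_space.variance M' X"
proof -
  interpret M: prob_space M by fact
  interpret M': prob_space M' by fact
  have X: "X \<in> borel_measurable M'" "integrable M' (\<lambda>x. (X x)\<^sup>2)" "M'.expectation X = 0"
    using assms(3) by (simp_all add: M'.centred_L2_def)
  have [measurable]: "(\<lambda>x::real. x\<^sup>2) \<in> borel_measurable borel"
    by simp
  have "M.expectation Y = M'.expectation X"
    using integral_distr[OF Y, of "\<lambda>x. x"] integral_distr[OF X(1), of "\<lambda>x. x"] eq by simp
  moreover have "integrable M (\<lambda>\<omega>. (Y \<omega>)\<^sup>2)"
    using integrable_distr_eq[OF Y, of "\<lambda>x. x\<^sup>2"] integrable_distr_eq[OF X(1), of "\<lambda>x. x\<^sup>2"] eq X(2)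
    by simp
  ultimately show cY: "M.centred_L2 Y"
    using X(3) Y by (simp add: M.centred_L2_def)
  have "M.expectation (\<lambda>\<omega>. (Y \<omega>)\<^sup>2) = M'.expectation (\<lambda>x. (X x)\<^sup>2)"
    using integral_distr[OF Y, of "\<lambda>x. x\<^sup>2"] integral_distr[OF X(1), of "\<lambda>x. x\<^sup>2"] eq by simp
  then show "M.variance Y = M'.variance X"
    using M.variance_centred_L2[OF cY] M'.variance_centred_L2[OF assms(3)] by simp
qed

theorem proposition4p3:
  fixes T :: "nat \<Rightarrow> mesh" and L :: real and W :: "real \<Rightarrow> real"
    and M :: "'a measure" and M' :: "'b measure"
    and X :: "'b \<Rightarrow> real" and eps :: "nat \<Rightarrow> nat \<Rightarrow> 'a \<Rightarrow> real"
  assumes T0: "is_triangulation (T 0)"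
    and Tk: "\<And>k. is_refinement (T k) (T (Suc k))"
    and L: "L > Sup {norm (vert (T 0) i - vert (T 0) j) | i j. (i, j) \<in> edges (T 0)}"
    and W: "W \<in> {0..<1} \<rightarrow> {0<..1}"
    and M: "prob_space M"
    and M': "prob_space M'"
    and X: "X \<in> borel_measurable M'" "integrable M' X" "integrable M' (\<lambda>x. (X x)\<^sup>2)"
      "prob_space.expectation M' X = 0"
    and indep: "prob_space.indep_vars M (\<lambda>_. borel) (eps 0) {1..nvert (T 0)}"
    and ident: "\<And>i. i \<in> {1..nvert (T 0)} \<Longrightarrow> distr M borel (eps 0 i) = distr M' borel X"
    and eps_Suc: "\<And>k l \<omega>. l \<in> {1..nvert (T (Suc k))} \<Longrightarrow> \<omega> \<in> space M \<Longrightarrow>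
      eps (Suc k) l \<omega> = wls_step L W T k (\<lambda>i. eps k i \<omega>) l"
    and nonneg: "\<And>k l i. l \<in> {1..nvert (T (Suc k))} \<Longrightarrow> i \<in> nbrs L T k l \<Longrightarrow>
      wls_coeff L W T k l i \<ge> 0"
  shows "\<forall>k\<ge>1. \<forall>l\<in>{1..nvert (T k)}.
    prob_space.variance M (eps k l)
      \<le> (MAX l\<in>{1..nvert (T 1)}. \<Sum>i\<in>nbrs L T 0 l. (wls_coeff L W T 0 l i)\<^sup>2)
          * prob_space.variance M' X"
proof -
  interpret M: prob_space M by (rule M)
  interpret M': prob_space M' by (rule M')
  define \<theta> where "\<theta> = (MAX l\<in>{1..nvert (T 1)}. \<Sum>i\<in>nbrs L T 0 l. (wls_coeff L W T 0 l i)\<^sup>2)"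
  have reg: "shape_regular L (T 0)"
    by (rule shape_regular_triangulation[OF T0 L])
  note step = wls_step_refinement[of L T W, OF reg Tk W]
  have fin: "finite (nbrs L T k l)" and nbrs: "nbrs L T k l \<subseteq> {1..nvert (T k)}" for k l
    by (auto simp: nbrs_def)
  have eps: "eps (Suc k) l \<omega> = (\<Sum>i\<in>nbrs L T k l. wls_coeff L W T k l i * eps k i \<omega>)"
    if "l \<in> {1..nvert (T (Suc k))}" "\<omega> \<in> space M" for k l \<omega>
    using eps_Suc[OF that] step(1)[OF that(1)] by simp
  have X': "M'.centred_L2 X"
    using X by (simp add: M'.centred_L2_def)
  have eps0: "M.centred_L2 (eps 0 i) \<and> M.variance (eps 0 i) = M'.variance X"
    if "i \<in> {1..nvert (T 0)}" for i
  proof -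
    have "eps 0 i \<in> borel_measurable M"
      using indep that by (simp add: M.indep_vars_def2)
    from centred_L2_cong_distr[OF M M' X' this ident[OF that]] show ?thesis
      by blast
  qed
  \<comment> \<open>Established for all levels first, since the convex-combination bound requires
    centred square-integrable inputs.\<close>
  have centred: "M.centred_L2 (eps k l)" if "l \<in> {1..nvert (T k)}" for k l
    using that
  proof (induction k arbitrary: l)
    case 0
    then show ?case using eps0 by blast
  next
    case (Suc k)
    show ?case
      by (rule M.convex_combination_centred_L2(1)[OF fin nonneg[OF Suc.prems] step(2)[OF Suc.prems]
            _ eps[OF Suc.prems]]) (use nbrs Suc.IH in blast)+
  qed
  have main: "M.variance (eps (Suc k) l) \<le> \<theta> * M'.variance X" if "l \<in> {1..nvert (T (Suc k))}" for k l
    using that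
  proof (induction k arbitrary: l)
    case 0
    have "M.variance (eps (Suc 0) l) = M.expectation (\<lambda>\<omega>. (eps (Suc 0) l \<omega>)\<^sup>2)"
      by (rule M.variance_centred_L2[OF centred[OF 0]])
    also have "\<dots> = M.expectation (\<lambda>\<omega>. (\<Sum>i\<in>nbrs L T 0 l. wls_coeff L W T 0 l i * eps 0 i \<omega>)\<^sup>2)"
      by (intro Bochner_Integration.integral_cong refl) (simp add: eps[OF 0])
    also have "\<dots> = (\<Sum>i\<in>nbrs L T 0 l. (wls_coeff L W T 0 l i)\<^sup>2 * M.variance (eps 0 i))"
      by (rule M.expectation_square_indep_sum[OF indep fin nbrs]) (use nbrs centred in blast)
    also have "\<dots> = (\<Sum>i\<in>nbrs L T 0 l. (wls_coeff L W T 0 l i)\<^sup>2 * M'.variance X)"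
    proof (intro sum.cong refl)
      fix i assume "i \<in> nbrs L T 0 l"
      then have "i \<in> {1..nvert (T 0)}"
        using nbrs by blast
      from eps0[OF this] show "(wls_coeff L W T 0 l i)\<^sup>2 * M.variance (eps 0 i) =
          (wls_coeff L W T 0 l i)\<^sup>2 * M'.variance X"
        by presburger
    qed
    also have "\<dots> = (\<Sum>i\<in>nbrs L T 0 l. (wls_coeff L W T 0 l i)\<^sup>2) * M'.variance X"
      by (rule sum_distrib_right[symmetric])
    \<comment> \<open>The row \<open>l\<close> is one of the finitely many rows in the maximum, and
      the variance factor is non-negative.\<close>
    also have "\<dots> \<le> \<theta> * M'.variance X"
      unfolding \<theta>_def using 0 by (intro mult_right_mono Max_ge integral_nonneg) auto
    finally show ?case .
  next
    case (Suc k)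
    have "M.variance (eps (Suc (Suc k)) l) \<le>
        (\<Sum>i\<in>nbrs L T (Suc k) l. wls_coeff L W T (Suc k) l i * M.variance (eps (Suc k) i))"
      by (rule M.convex_combination_centred_L2(2)[OF fin nonneg[OF Suc.prems] step(2)[OF Suc.prems]
            _ eps[OF Suc.prems]]) (use nbrs centred in blast)+
    \<comment> \<open>The induction hypothesis bounds all variances of the previous level by one
      constant, which the coefficients, summing to 1, reproduce.\<close>
    also have "\<dots> \<le> (\<Sum>i\<in>nbrs L T (Suc k) l. wls_coeff L W T (Suc k) l i * (\<theta> * M'.variance X))"
      using nbrs by (intro sum_mono mult_left_mono Suc.IH nonneg[OF Suc.prems]) blast+
    also have "\<dots> = \<theta> * M'.variance X"
      using step(2)[OF Suc.prems] by (simp flip: sum_distrib_right)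
    finally show ?case .
  qed
  show ?thesis
  proof (intro allI impI ballI)
    fix k l :: nat assume "k \<ge> 1" "l \<in> {1..nvert (T k)}"
    then show "M.variance (eps k l)
        \<le> (MAX l\<in>{1..nvert (T 1)}. \<Sum>i\<in>nbrs L T 0 l. (wls_coeff L W T 0 l i)\<^sup>2) * M'.variance X"
      using main[of l "k - 1"] by (simp add: \<theta>_def)
  qed
qed

end
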